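(* Let $\mathcal{A}$ be a consistent $\mathrm{LE}$-$\mathcal{FALC}$ ABox and let $\mathcal{A}'$ be obtained by applying any tableaux expansion rule to $\mathcal{A}$. Then $\mathcal{A}'$ is also consistent.
   Context: $\mathbf{H}$ is a complete and completely distributive Heyting algebra; an ABox is consistent if it has a model (an $\mathbf{H}$-valued enriched formal context with an interpretation satisfying all its assertions $\alpha\le t$, $\alpha\not\le t$). The expansion rules are: (create) for each concept $C$ occurring in the ABox add $1\le a_C:C$, $1\le x_C::C$; ($I$) from $\alpha_1\le b:C$, $\alpha_2\le y::C$ add $\alpha_1\wedge\alpha_2\le I(b,y)$; ($\wedge_A$), ($\vee_X$) decomposition rules; ($\Box$) from $\alpha_1\le b:[R_\Box]C$, $\alpha_2\le y::C$ add $\alpha_1\wedge\alpha_2\le R_\Box(b,y)$; ($\Diamond$) from $\alpha_1\le y::\langle R_\Diamond\rangle C$, $\alpha_2\le b:C$ add $\alpha_1\wedge\alpha_2\le R_\Diamond(y,b)$; ($I$-compatibility) from $\alpha\le I(b,\Box y)$, $\alpha\le I(b,\blacksquare y)$, $\alpha\le I(\Diamond b,y)$, $\alpha\le I(\Diamond^{\bullet} b,y)$ add respectively $\alpha\le R_\Box(b,y)$, $\alpha\le R_\Diamond(y,b)$, $\alpha\le R_\Diamond(y,b)$, $\alpha\le R_\Box(b,y)$; (inverse) recombine $\wedge$ on objects and $\vee$ on features for concepts already occurring; (adjunction) from $\alpha\le R_\Box(b,y)$ add $\alpha\le I(\Diamond^{\bullet} b,y)$, $\alpha\le I(b,\Box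 y)$ and from $\alpha\le R_\Diamond(y,b)$ add $\alpha\le I(\Diamond b,y)$, $\alpha\le I(b,\blacksquare y)$, with new names (except $\Diamond a_C=a_{\langle R_\Diamond\rangle C}$, $\Box x_C=x_{[R_\Box]C}$), where $\Diamond^{\bullet}$ is the black-diamond left adjoint of $\Box$ and $\blacksquare$ the right adjoint of $\Diamond$; (negative) from $\alpha\not\le b:C$ add $\alpha\not\le I(b,x_C)$, from $\alpha\not\le y::C$ add $\alpha\not\le I(a_C,y)$; (appending) from $\alpha\le I(b,x_C)$ add $\alpha\le b:C$, from $\alpha\le I(a_C,y)$ add $\alpha\le y::C$; ($MV_\vee$) from $\alpha_1\le t$, $\alpha_2\le t$ add $\alpha_1\vee\alpha_2\le t$. The proof uses that any model of $\mathcal{A}$ extends to a model with classifying objects $a_C$ and features $x_C$ for every concept (extension $=$ $I$-image of $x_C$, intension $=$ $I$-image of $a_C$) and with elements $\Diamond^{\bullet} b,\Diamond b,\Box y,\blacksquare y$ realising the adjunction identities, preserving the values of all concepts on the original individuals.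
   Formalization: The ABox is assumed to arise by finitely many (possibly zero) rule applications from one without the reserved names a_C, x_C, ◇b, etc.; otherwise the claim fails, e.g. {1 ≤ I(b,x_C), 1 ≰ b:C} is consistent but the appending rule makes it inconsistent. *)

theory Defs
  imports Main
begin

text \<open>The class \<open>complete_distrib_lattice\<close> is full (choice-function) complete distributivity, so
  every such lattice is a complete Heyting algebra, whose implication is the residual of meet.\<close>

definition himp :: "'h::complete_distrib_lattice \<Rightarrow> 'h \<Rightarrow> 'h" (infixr "\<rightarrow>\<^sub>H" 60) where
  "a \<rightarrow>\<^sub>H b = Sup {c. inf a c \<le> b}"

lemma himp_residual: "c \<le> (a \<rightarrow>\<^sub>H b) \<longleftrightarrow> inf a c \<le> b"
proof
  assume "c \<le> (a \<rightarrow>\<^sub>H b)"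
  then have "inf a c \<le> inf a (Sup {c. inf a c \<le> b})"
    unfolding himp_def by (rule inf_mono[OF order_refl])
  also have "\<dots> \<le> b"
    by (simp add: inf_Sup SUP_le_iff)
  finally show "inf a c \<le> b" .
next
  assume "inf a c \<le> b"
  then show "c \<le> (a \<rightarrow>\<^sub>H b)"
    unfolding himp_def by (simp add: Sup_upper)
qed

text \<open>For \<open>R : U \<times> W \<rightarrow> H\<close> these are the maps \<open>R\<^sup>(\<^sup>1\<^sup>)[f]\<close> and \<open>R\<^sup>(\<^sup>0\<^sup>)[u]\<close>. For the incidence relation
  they are the polarity maps (written as an up arrow and a down arrow in formal concept analysis).
  They are used both for relations from objects to features and from features to objects.\<close>

definition pol1 :: "('u \<Rightarrow> 'w \<Rightarrow> 'h::complete_distrib_lattice) \<Rightarrow> ('u \<Rightarrow> 'h) \<Rightarrow> 'w \<Rightarrow> 'h" where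
  "pol1 R f = (\<lambda>w. INF u. f u \<rightarrow>\<^sub>H R u w)"

definition pol0 :: "('u \<Rightarrow> 'w \<Rightarrow> 'h::complete_distrib_lattice) \<Rightarrow> ('w \<Rightarrow> 'h) \<Rightarrow> 'u \<Rightarrow> 'h" where
  "pol0 R g = (\<lambda>u. INF w. g w \<rightarrow>\<^sub>H R u w)"

definition stable_ext :: "('a \<Rightarrow> 'x \<Rightarrow> 'h::complete_distrib_lattice) \<Rightarrow> ('a \<Rightarrow> 'h) \<Rightarrow> bool" where
  "stable_ext I f \<longleftrightarrow> pol0 I (pol1 I f) = f"

definition stable_int :: "('a \<Rightarrow> 'x \<Rightarrow> 'h::complete_distrib_lattice) \<Rightarrow> ('x \<Rightarrow> 'h) \<Rightarrow> bool" where
  "stable_int I u \<longleftrightarrow> pol1 I (pol0 I u) = u"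

definition is_fconcept ::
    "('a \<Rightarrow> 'x \<Rightarrow> 'h::complete_distrib_lattice) \<Rightarrow> ('a \<Rightarrow> 'h) \<times> ('x \<Rightarrow> 'h) \<Rightarrow> bool" where
  "is_fconcept I c \<longleftrightarrow> pol1 I (fst c) = snd c \<and> pol0 I (snd c) = fst c"

definition point :: "'h::complete_distrib_lattice \<Rightarrow> 'u \<Rightarrow> 'u \<Rightarrow> 'h" where
  "point \<alpha> u = (\<lambda>_. bot)(u := \<alpha>)"

definition compat_box ::
    "('a \<Rightarrow> 'x \<Rightarrow> 'h::complete_distrib_lattice) \<Rightarrow> ('a \<Rightarrow> 'x \<Rightarrow> 'h) \<Rightarrow> bool" where
  "compat_box I R \<longleftrightarrow>
     (\<forall>\<alpha> x. stable_ext I (pol0 R (point \<alpha> x))) \<and>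
     (\<forall>\<alpha> a. stable_int I (pol1 R (point \<alpha> a)))"

definition compat_dia ::
    "('a \<Rightarrow> 'x \<Rightarrow> 'h::complete_distrib_lattice) \<Rightarrow> ('x \<Rightarrow> 'a \<Rightarrow> 'h) \<Rightarrow> bool" where
  "compat_dia I R \<longleftrightarrow>
     (\<forall>\<alpha> a. stable_int I (pol0 R (point \<alpha> a))) \<and>
     (\<forall>\<alpha> x. stable_ext I (pol1 R (point \<alpha> x)))"

text \<open>The sets of objects and features are the types \<open>'a\<close> and \<open>'x\<close>; \<open>'r\<close> and \<open>'s\<close> are the names
  of the box relations and of the diamond relations (a single relation of each kind is the
  instance \<open>'r = 's = unit\<close>).\<close>

record ('a, 'x, 'h, 'r, 's) efc =
  inc :: "'a \<Rightarrow> 'x \<Rightarrow> 'h"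
  rbox :: "'r \<Rightarrow> 'a \<Rightarrow> 'x \<Rightarrow> 'h"
  rdia :: "'s \<Rightarrow> 'x \<Rightarrow> 'a \<Rightarrow> 'h"

definition enriched_fcontext ::
    "('a, 'x, 'h::complete_distrib_lattice, 'r, 's) efc \<Rightarrow> bool" where
  "enriched_fcontext F \<longleftrightarrow>
     (\<forall>r. compat_box (inc F) (rbox F r)) \<and> (\<forall>s. compat_dia (inc F) (rdia F s))"

datatype ('d, 'r, 's) concept =
    Atom 'd
  | Top
  | Bot
  | And "('d, 'r, 's) concept" "('d, 'r, 's) concept"
  | Or "('d, 'r, 's) concept" "('d, 'r, 's) concept"
  | Box 'r "('d, 'r, 's) concept"
  | Dia 's "('d, 'r, 's) concept"

text \<open>Individual names: the given ones together with the reserved names introduced by the tableaux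
  rules. \<open>CObj C\<close> is \<open>a\<^sub>C\<close>, \<open>CFeat C\<close> is \<open>x\<^sub>C\<close>, and \<open>BDiaObj\<close>, \<open>BBoxFeat\<close> stand for the black diamond
  and the black box.\<close>

datatype ('o, 'd, 'r, 's) obj =
    Obj 'o
  | CObj "('d, 'r, 's) concept"
  | DiaObj 's "('o, 'd, 'r, 's) obj"
  | BDiaObj 'r "('o, 'd, 'r, 's) obj"

datatype ('f, 'd, 'r, 's) feat =
    Feat 'f
  | CFeat "('d, 'r, 's) concept"
  | BoxFeat 'r "('f, 'd, 'r, 's) feat"
  | BBoxFeat 's "('f, 'd, 'r, 's) feat"

text \<open>The rules below build names with these functions, which identify the diamond of \<open>a\<^sub>C\<close> with the
  classifying object of the diamond of \<open>C\<close>, and dually for features; every other name is new.\<close>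

fun dia_obj :: "'s \<Rightarrow> ('o, 'd, 'r, 's) obj \<Rightarrow> ('o, 'd, 'r, 's) obj" where
  "dia_obj s (CObj C) = CObj (Dia s C)"
| "dia_obj s b = DiaObj s b"

fun box_feat :: "'r \<Rightarrow> ('f, 'd, 'r, 's) feat \<Rightarrow> ('f, 'd, 'r, 's) feat" where
  "box_feat r (CFeat C) = CFeat (Box r C)"
| "box_feat r y = BoxFeat r y"

datatype ('o, 'f, 'd, 'r, 's) aterm =
    ObjIn "('o, 'd, 'r, 's) obj" "('d, 'r, 's) concept"    \<comment> \<open>\<open>b : C\<close>\<close>
  | FeatIn "('f, 'd, 'r, 's) feat" "('d, 'r, 's) concept"  \<comment> \<open>\<open>y :: C\<close>\<close>
  | Inc "('o, 'd, 'r, 's) obj" "('f, 'd, 'r, 's) feat"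
  | RBox 'r "('o, 'd, 'r, 's) obj" "('f, 'd, 'r, 's) feat"
  | RDia 's "('f, 'd, 'r, 's) feat" "('o, 'd, 'r, 's) obj"

datatype ('o, 'f, 'd, 'r, 's, 'h) assertion =
    Leq 'h "('o, 'f, 'd, 'r, 's) aterm"
  | NLeq 'h "('o, 'f, 'd, 'r, 's) aterm"

type_synonym ('o, 'f, 'd, 'r, 's, 'h) abox = "('o, 'f, 'd, 'r, 's, 'h) assertion set"

record ('a, 'x, 'h, 'o, 'f, 'd, 'r, 's) interp =
  iobj :: "('o, 'd, 'r, 's) obj \<Rightarrow> 'a"
  ifeat :: "('f, 'd, 'r, 's) feat \<Rightarrow> 'x"
  iatom :: "'d \<Rightarrow> ('a \<Rightarrow> 'h) \<times> ('x \<Rightarrow> 'h)"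

text \<open>The interpretation of a concept is a pair (extension, intension).\<close>

fun cval :: "('a, 'x, 'h::complete_distrib_lattice, 'r, 's) efc
    \<Rightarrow> ('d \<Rightarrow> ('a \<Rightarrow> 'h) \<times> ('x \<Rightarrow> 'h)) \<Rightarrow> ('d, 'r, 's) concept \<Rightarrow> ('a \<Rightarrow> 'h) \<times> ('x \<Rightarrow> 'h)" where
  "cval F V (Atom D) = V D"
| "cval F V Top = ((\<lambda>_. top), pol1 (inc F) (\<lambda>_. top))"
| "cval F V Bot = (pol0 (inc F) (\<lambda>_. top), (\<lambda>_. top))"
| "cval F V (And C D) =
     (let f = (\<lambda>a. inf (fst (cval F V C) a) (fst (cval F V D) a)) in (f, pol1 (inc F) f))"
| "cval F V (Or C D) =
     (let u = (\<lambda>x. inf (snd (cval F V C) x) (snd (cval F V D) x)) in (pol0 (inc F) u, u))"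
| "cval F V (Box r C) =
     (let f = pol0 (rbox F r) (snd (cval F V C)) in (f, pol1 (inc F) f))"
| "cval F V (Dia s C) =
     (let u = pol0 (rdia F s) (fst (cval F V C)) in (pol0 (inc F) u, u))"

fun tval :: "('a, 'x, 'h::complete_distrib_lattice, 'r, 's) efc
    \<Rightarrow> ('a, 'x, 'h, 'o, 'f, 'd, 'r, 's) interp \<Rightarrow> ('o, 'f, 'd, 'r, 's) aterm \<Rightarrow> 'h" where
  "tval F J (ObjIn b C) = fst (cval F (iatom J) C) (iobj J b)"
| "tval F J (FeatIn y C) = snd (cval F (iatom J) C) (ifeat J y)"
| "tval F J (Inc b y) = inc F (iobj J b) (ifeat J y)"
| "tval F J (RBox r b y) = rbox F r (iobj J b) (ifeat J y)"
| "tval F J (RDia s y b) = rdia F s (ifeat J y) (iobj J b)"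

fun sat :: "('a, 'x, 'h::complete_distrib_lattice, 'r, 's) efc
    \<Rightarrow> ('a, 'x, 'h, 'o, 'f, 'd, 'r, 's) interp \<Rightarrow> ('o, 'f, 'd, 'r, 's, 'h) assertion \<Rightarrow> bool" where
  "sat F J (Leq \<alpha> t) \<longleftrightarrow> \<alpha> \<le> tval F J t"
| "sat F J (NLeq \<alpha> t) \<longleftrightarrow> \<not> \<alpha> \<le> tval F J t"

definition is_model :: "('a, 'x, 'h::complete_distrib_lattice, 'r, 's) efc
    \<Rightarrow> ('a, 'x, 'h, 'o, 'f, 'd, 'r, 's) interp \<Rightarrow> ('o, 'f, 'd, 'r, 's, 'h) abox \<Rightarrow> bool" where
  "is_model F J \<A> \<longleftrightarrow>
     enriched_fcontext F \<and> (\<forall>D. is_fconcept (inc F) (iatom J D)) \<and> (\<forall>\<phi>\<in>\<A>. sat F J \<phi>)"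

text \<open>Reserved names are interpreted like any other name: no special meaning is imposed on them.
  A formula cannot quantify over the types of objects and features, so consistency carries these
  types as parameters; that an ABox is consistent means that this holds for some \<open>'a\<close> and \<open>'x\<close>.
  So a consistency hypothesis is stated for arbitrary type variables, and a consistency conclusion
  for specific witness types; the types of individual names suffice as witnesses, since every
  element needed to evaluate the assertions can be given a name.\<close>

definition consistent_in :: "'a itself \<Rightarrow> 'x itself
    \<Rightarrow> ('o, 'f, 'd, 'r, 's, 'h::complete_distrib_lattice) abox \<Rightarrow> bool" where
  "consistent_in _ _ \<A> \<longleftrightarrow>
     (\<exists>(F :: ('a, 'x, 'h, 'r, 's) efc) J. is_model F J \<A>)"

fun subconcepts :: "('d, 'r, 's) concept \<Rightarrow> ('d, 'r, 's) concept set" where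
  "subconcepts (Atom D) = {Atom D}"
| "subconcepts Top = {Top}"
| "subconcepts Bot = {Bot}"
| "subconcepts (And C D) = insert (And C D) (subconcepts C \<union> subconcepts D)"
| "subconcepts (Or C D) = insert (Or C D) (subconcepts C \<union> subconcepts D)"
| "subconcepts (Box r C) = insert (Box r C) (subconcepts C)"
| "subconcepts (Dia s C) = insert (Dia s C) (subconcepts C)"

fun term_of :: "('o, 'f, 'd, 'r, 's, 'h) assertion \<Rightarrow> ('o, 'f, 'd, 'r, 's) aterm" where
  "term_of (Leq \<alpha> t) = t"
| "term_of (NLeq \<alpha> t) = t"

fun term_concepts :: "('o, 'f, 'd, 'r, 's) aterm \<Rightarrow> ('d, 'r, 's) concept set" where
  "term_concepts (ObjIn b C) = subconcepts C"
| "term_concepts (FeatIn y C) = subconcepts C"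
| "term_concepts _ = {}"

definition occurring :: "('o, 'f, 'd, 'r, 's, 'h) abox \<Rightarrow> ('d, 'r, 's) concept set" where
  "occurring \<A> = (\<Union>\<phi>\<in>\<A>. term_concepts (term_of \<phi>))"

inductive expands :: "('o, 'f, 'd, 'r, 's, 'h::complete_distrib_lattice) abox
    \<Rightarrow> ('o, 'f, 'd, 'r, 's, 'h) abox \<Rightarrow> bool" where
  create: "C \<in> occurring \<A> \<Longrightarrow>
    expands \<A> (\<A> \<union> {Leq top (ObjIn (CObj C) C), Leq top (FeatIn (CFeat C) C)})"
| I_rule: "Leq \<alpha>1 (ObjIn b C) \<in> \<A> \<Longrightarrow> Leq \<alpha>2 (FeatIn y C) \<in> \<A> \<Longrightarrow>
    expands \<A> (\<A> \<union> {Leq (inf \<alpha>1 \<alpha>2) (Inc b y)})"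
| and_obj: "Leq \<alpha> (ObjIn b (And C D)) \<in> \<A> \<Longrightarrow>
    expands \<A> (\<A> \<union> {Leq \<alpha> (ObjIn b C), Leq \<alpha> (ObjIn b D)})"
| or_feat: "Leq \<alpha> (FeatIn y (Or C D)) \<in> \<A> \<Longrightarrow>
    expands \<A> (\<A> \<union> {Leq \<alpha> (FeatIn y C), Leq \<alpha> (FeatIn y D)})"
| box_rule: "Leq \<alpha>1 (ObjIn b (Box r C)) \<in> \<A> \<Longrightarrow> Leq \<alpha>2 (FeatIn y C) \<in> \<A> \<Longrightarrow>
    expands \<A> (\<A> \<union> {Leq (inf \<alpha>1 \<alpha>2) (RBox r b y)})"
| dia_rule: "Leq \<alpha>1 (FeatIn y (Dia s C)) \<in> \<A> \<Longrightarrow> Leq \<alpha>2 (ObjIn b C) \<in> \<A> \<Longrightarrow>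
    expands \<A> (\<A> \<union> {Leq (inf \<alpha>1 \<alpha>2) (RDia s y b)})"
| compat_box_feat: "Leq \<alpha> (Inc b (box_feat r y)) \<in> \<A> \<Longrightarrow>
    expands \<A> (\<A> \<union> {Leq \<alpha> (RBox r b y)})"
| compat_bbox_feat: "Leq \<alpha> (Inc b (BBoxFeat s y)) \<in> \<A> \<Longrightarrow>
    expands \<A> (\<A> \<union> {Leq \<alpha> (RDia s y b)})"
| compat_dia_obj: "Leq \<alpha> (Inc (dia_obj s b) y) \<in> \<A> \<Longrightarrow>
    expands \<A> (\<A> \<union> {Leq \<alpha> (RDia s y b)})"
| compat_bdia_obj: "Leq \<alpha> (Inc (BDiaObj r b) y) \<in> \<A> \<Longrightarrow>
    expands \<A> (\<A> \<union> {Leq \<alpha> (RBox r b y)})"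
| inv_and: "Leq \<alpha>1 (ObjIn b C) \<in> \<A> \<Longrightarrow> Leq \<alpha>2 (ObjIn b D) \<in> \<A> \<Longrightarrow> And C D \<in> occurring \<A> \<Longrightarrow>
    expands \<A> (\<A> \<union> {Leq (inf \<alpha>1 \<alpha>2) (ObjIn b (And C D))})"
| inv_or: "Leq \<alpha>1 (FeatIn y C) \<in> \<A> \<Longrightarrow> Leq \<alpha>2 (FeatIn y D) \<in> \<A> \<Longrightarrow> Or C D \<in> occurring \<A> \<Longrightarrow>
    expands \<A> (\<A> \<union> {Leq (inf \<alpha>1 \<alpha>2) (FeatIn y (Or C D))})"
| adj_box: "Leq \<alpha> (RBox r b y) \<in> \<A> \<Longrightarrow>
    expands \<A> (\<A> \<union> {Leq \<alpha> (Inc (BDiaObj r b) y), Leq \<alpha> (Inc b (box_feat r y))})"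
| adj_dia: "Leq \<alpha> (RDia s y b) \<in> \<A> \<Longrightarrow>
    expands \<A> (\<A> \<union> {Leq \<alpha> (Inc (dia_obj s b) y), Leq \<alpha> (Inc b (BBoxFeat s y))})"
| neg_obj: "NLeq \<alpha> (ObjIn b C) \<in> \<A> \<Longrightarrow>
    expands \<A> (\<A> \<union> {NLeq \<alpha> (Inc b (CFeat C))})"
| neg_feat: "NLeq \<alpha> (FeatIn y C) \<in> \<A> \<Longrightarrow>
    expands \<A> (\<A> \<union> {NLeq \<alpha> (Inc (CObj C) y)})"
| append_obj: "Leq \<alpha> (Inc b (CFeat C)) \<in> \<A> \<Longrightarrow>
    expands \<A> (\<A> \<union> {Leq \<alpha> (ObjIn b C)})"
| append_feat: "Leq \<alpha> (Inc (CObj C) y) \<in> \<A> \<Longrightarrow>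
    expands \<A> (\<A> \<union> {Leq \<alpha> (FeatIn y C)})"
| mv_or: "Leq \<alpha>1 t \<in> \<A> \<Longrightarrow> Leq \<alpha>2 t \<in> \<A> \<Longrightarrow>
    expands \<A> (\<A> \<union> {Leq (sup \<alpha>1 \<alpha>2) t})"

text \<open>The names \<open>a\<^sub>C\<close>, \<open>x\<^sub>C\<close> etc. are reserved for the rules, which introduce them as new names. So an
  input ABox mentions given names only, and the ABoxes to which rules are applied are those arising
  from an input ABox by finitely many (possibly zero) expansion steps. Without this freshness
  convention a rule could destroy consistency: \<open>1 \<le> I(b, x\<^sub>C)\<close> together with the negation of
  \<open>1 \<le> b : C\<close> has a model in which the name \<open>x\<^sub>C\<close> is interpreted arbitrarily.\<close>

fun given_names_only :: "('o, 'f, 'd, 'r, 's) aterm \<Rightarrow> bool" where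
  "given_names_only (ObjIn b C) \<longleftrightarrow> b \<in> range Obj"
| "given_names_only (FeatIn y C) \<longleftrightarrow> y \<in> range Feat"
| "given_names_only (Inc b y) \<longleftrightarrow> b \<in> range Obj \<and> y \<in> range Feat"
| "given_names_only (RBox r b y) \<longleftrightarrow> b \<in> range Obj \<and> y \<in> range Feat"
| "given_names_only (RDia s y b) \<longleftrightarrow> b \<in> range Obj \<and> y \<in> range Feat"

inductive le_falc_abox :: "('o, 'f, 'd, 'r, 's, 'h::complete_distrib_lattice) abox \<Rightarrow> bool" where
  input: "(\<And>\<phi>. \<phi> \<in> \<A> \<Longrightarrow> given_names_only (term_of \<phi>)) \<Longrightarrow> le_falc_abox \<A>"
| expand: "le_falc_abox \<A> \<Longrightarrow> expands \<A> \<A>' \<Longrightarrow> le_falc_abox \<A>'"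

end

(* A model of the input ABox is replaced by one whose objects and features are the individual names.
   Each object name denotes a graded set of objects of the given model, a classifying name a_C being
   the extension of C, and each feature name a graded set of features; incidence and all relations
   are lifted to graded sets by infima of implications. Relational compatibility then holds because
   a row or column of a lifted relation is a row or column of the lifted incidence at an adjoint
   name. The extension of C at b is I(b, x_C) and its intension at y is I(a_C, y), since an infimum
   over all names weighted by subsethood in a concept is attained at its classifying name. In such
   a model every expansion rule is sound. *)

theory Submission
  imports Defs
begin

section \<open>Polarity maps as a Galois connection\<close>

lemma le_pol0: "c \<le> pol0 R g u \<longleftrightarrow> (\<forall>w. inf (g w) c \<le> R u w)"
  by (simp add: pol0_def le_INF_iff himp_residual)

lemma le_pol1: "c \<le> pol1 R f w \<longleftrightarrow> (\<forall>u. inf (f u) c \<le> R u w)"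
  by (simp add: pol1_def le_INF_iff himp_residual)

lemma pol_galois: "f \<le> pol0 R g \<longleftrightarrow> g \<le> pol1 R f"
  by (auto simp: le_fun_def le_pol0 le_pol1 inf_commute)

lemma pol0_antimono: "g \<le> g' \<Longrightarrow> pol0 R g' \<le> pol0 R g"
  using order_trans pol_galois by blast

lemma pol1_antimono: "f \<le> f' \<Longrightarrow> pol1 R f' \<le> pol1 R f"
  using order_trans pol_galois by blast

lemma pol_ext_closure: "f \<le> pol0 R (pol1 R f)"
  by (simp add: pol_galois)

lemma pol_int_closure: "g \<le> pol1 R (pol0 R g)"
  by (simp flip: pol_galois)

lemma pol010: "pol0 R (pol1 R (pol0 R g)) = pol0 R g"
  by (intro antisym pol_ext_closure pol0_antimono pol_int_closure)

lemma pol101: "pol1 R (pol0 R (pol1 R f)) = pol1 R f"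
  by (intro antisym pol_int_closure pol1_antimono pol_ext_closure)

lemma le_iff_eqI: "(\<And>c. c \<le> x \<longleftrightarrow> c \<le> y) \<Longrightarrow> x = (y::'h::order)"
  by (blast intro: antisym)

lemma top_himp: "(top \<rightarrow>\<^sub>H b) = b"
  by (rule le_iff_eqI) (simp add: himp_residual)

lemma pol0_point: "pol0 R (point \<alpha> w) u = (\<alpha> \<rightarrow>\<^sub>H R u w)"
  by (rule le_iff_eqI) (auto simp: le_pol0 himp_residual point_def)

lemma pol1_point: "pol1 R (point \<alpha> u) w = (\<alpha> \<rightarrow>\<^sub>H R u w)"
  by (rule le_iff_eqI) (auto simp: le_pol1 himp_residual point_def)

section \<open>Stability, and compatibility beyond point sets\<close>

lemma stable_extI: "(\<And>u. pol0 I (pol1 I f) u \<le> f u) \<Longrightarrow> stable_ext I f"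
  unfolding stable_ext_def by (rule antisym[OF _ pol_ext_closure]) (rule le_funI)

lemma stable_intI: "(\<And>u. pol1 I (pol0 I f) u \<le> f u) \<Longrightarrow> stable_int I f"
  unfolding stable_int_def by (rule antisym[OF _ pol_int_closure]) (rule le_funI)

lemma stable_ext_le: "stable_ext I h \<Longrightarrow> f \<le> h \<Longrightarrow> pol0 I (pol1 I f) u \<le> h u"
  using le_funD[OF pol0_antimono[OF pol1_antimono]] by (metis stable_ext_def)

lemma stable_int_le: "stable_int I h \<Longrightarrow> f \<le> h \<Longrightarrow> pol1 I (pol0 I f) u \<le> h u"
  using le_funD[OF pol1_antimono[OF pol0_antimono]] by (metis stable_int_def)

lemma pol0_le_point: "pol0 R g \<le> pol0 R (point (g w) w)"
  by (rule pol0_antimono) (simp add: le_fun_def point_def)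

lemma pol1_le_point: "pol1 R f \<le> pol1 R (point (f u) u)"
  by (rule pol1_antimono) (simp add: le_fun_def point_def)

text \<open>A graded set is the join of its points \<open>point (g w) w\<close>, and
  \<open>pol0 R\<close> turns joins into meets. With \<open>pol0_le_point\<close> this makes
  \<open>pol0 R g\<close> the meet of its values at points.\<close>

lemma pol0_geI: "(\<And>w. c \<le> pol0 R (point (g w) w) u) \<Longrightarrow> c \<le> pol0 R g u"
  by (simp add: le_pol0 pol0_point himp_residual)

lemma pol1_geI: "(\<And>u. c \<le> pol1 R (point (f u) u) w) \<Longrightarrow> c \<le> pol1 R f w"
  by (simp add: le_pol1 pol1_point himp_residual)

text \<open>Compatibility speaks of point sets only. The closure of \<open>pol0 R g\<close> lies
  below each stable set \<open>pol0 R (point (g w) w)\<close>, hence below their meet, which is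
  \<open>pol0 R g\<close> itself; dually for \<open>pol1\<close>.\<close>

lemma compat_box_stable:
  assumes "compat_box I R"
  shows "pol0 I (pol1 I (pol0 R g)) = pol0 R g" "pol1 I (pol0 I (pol1 R f)) = pol1 R f"
proof -
  have "stable_ext I (pol0 R (point (g w) w))" for w
    using assms by (simp add: compat_box_def)
  then have "pol0 I (pol1 I (pol0 R g)) u \<le> pol0 R (point (g w) w) u" for u w
    by (rule stable_ext_le) (rule pol0_le_point)
  then have "stable_ext I (pol0 R g)"
    by (rule stable_extI[OF pol0_geI])
  then show "pol0 I (pol1 I (pol0 R g)) = pol0 R g"
    by (simp add: stable_ext_def)
  have "stable_int I (pol1 R (point (f u) u))" for u
    using assms by (simp add: compat_box_def)
  then have "pol1 I (pol0 I (pol1 R f)) u \<le> pol1 R (point (f w) w) u" for u w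
    by (rule stable_int_le) (rule pol1_le_point)
  then have "stable_int I (pol1 R f)"
    by (rule stable_intI[OF pol1_geI])
  then show "pol1 I (pol0 I (pol1 R f)) = pol1 R f"
    by (simp add: stable_int_def)
qed

lemma compat_dia_stable:
  assumes "compat_dia I R"
  shows "pol1 I (pol0 I (pol0 R f)) = pol0 R f" "pol0 I (pol1 I (pol1 R g)) = pol1 R g"
proof -
  have "stable_int I (pol0 R (point (f w) w))" for w
    using assms by (simp add: compat_dia_def)
  then have "pol1 I (pol0 I (pol0 R f)) u \<le> pol0 R (point (f w) w) u" for u w
    by (rule stable_int_le) (rule pol0_le_point)
  then have "stable_int I (pol0 R f)"
    by (rule stable_intI[OF pol0_geI])
  then show "pol1 I (pol0 I (pol0 R f)) = pol0 R f"
    by (simp add: stable_int_def)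
  have "stable_ext I (pol1 R (point (g u) u))" for u
    using assms by (simp add: compat_dia_def)
  then have "pol0 I (pol1 I (pol1 R g)) u \<le> pol1 R (point (g w) w) u" for u w
    by (rule stable_ext_le) (rule pol1_le_point)
  then have "stable_ext I (pol1 R g)"
    by (rule stable_extI[OF pol1_geI])
  then show "pol0 I (pol1 I (pol1 R g)) = pol1 R g"
    by (simp add: stable_ext_def)
qed

lemma stable_ext_inf:
  "stable_ext I f \<Longrightarrow> stable_ext I g \<Longrightarrow> stable_ext I (\<lambda>u. inf (f u) (g u))"
  by (rule stable_extI, rule le_infI) (rule stable_ext_le, assumption, simp add: le_fun_def)+

lemma stable_int_inf:
  "stable_int I f \<Longrightarrow> stable_int I g \<Longrightarrow> stable_int I (\<lambda>w. inf (f w) (g w))"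
  by (rule stable_intI, rule le_infI) (rule stable_int_le, assumption, simp add: le_fun_def)+

text \<open>Each clause of \<open>cval\<close> fixes one component and obtains the other by a
  polarity map, so only stability of the fixed component is at stake. In the modal cases it is the
  image of an arbitrary graded set, not of a point.\<close>

lemma is_fconcept_cval:
  assumes F: "enriched_fcontext F" and V: "\<And>D. is_fconcept (inc F) (V D)"
  shows "is_fconcept (inc F) (cval F V C)"
proof (induction C)
  case (And C D)
  then have "stable_ext (inc F) (fst (cval F V C))" "stable_ext (inc F) (fst (cval F V D))"
    by (simp_all add: is_fconcept_def stable_ext_def)
  from stable_ext_inf[OF this] show ?case
    by (simp add: is_fconcept_def Let_def stable_ext_def)
next
  case (Or C D)
  then have "stable_int (inc F) (snd (cval F V C))" "stable_int (inc F) (snd (cval F V D))"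
    by (simp_all add: is_fconcept_def stable_int_def)
  from stable_int_inf[OF this] show ?case
    by (simp add: is_fconcept_def Let_def stable_int_def)
next
  case Top
  have "stable_ext (inc F) (\<lambda>_. top)"
    by (rule stable_extI) simp
  then show ?case by (simp add: is_fconcept_def stable_ext_def)
next
  case Bot
  have "stable_int (inc F) (\<lambda>_. top)"
    by (rule stable_intI) simp
  then show ?case by (simp add: is_fconcept_def stable_int_def)
next
  case (Box r C)
  with F show ?case
    by (simp add: is_fconcept_def Let_def enriched_fcontext_def compat_box_stable)
next
  case (Dia s C)
  with F show ?case
    by (simp add: is_fconcept_def Let_def enriched_fcontext_def compat_dia_stable)
qed (simp add: V)

section \<open>Lifting relations to graded sets\<close>

definition graded_subset :: "('u \<Rightarrow> 'h::complete_distrib_lattice) \<Rightarrow> ('u \<Rightarrow> 'h) \<Rightarrow> 'h" where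
  "graded_subset f e = (INF u. f u \<rightarrow>\<^sub>H e u)"

text \<open>By residuation this is the infimum over all \<open>u\<close>, \<open>w\<close> of the
  degree to which \<open>f u\<close> and \<open>g w\<close> together imply \<open>R u w\<close>. The
  one-sided form exposes it as a degree of inclusion.\<close>

definition lift_rel ::
    "('u \<Rightarrow> 'w \<Rightarrow> 'h::complete_distrib_lattice) \<Rightarrow> ('u \<Rightarrow> 'h) \<Rightarrow> ('w \<Rightarrow> 'h) \<Rightarrow> 'h" where
  "lift_rel R f g = graded_subset f (pol0 R g)"

lemma le_graded_subset: "c \<le> graded_subset f e \<longleftrightarrow> (\<forall>u. inf (f u) c \<le> e u)"
  by (simp add: graded_subset_def le_INF_iff himp_residual)

lemma graded_subset_mp: "inf (f u) (graded_subset f e) \<le> e u"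
  using le_graded_subset[of "graded_subset f e" f e] by simp

lemma graded_subset_refl: "graded_subset e e = top"
  by (simp add: top_unique[symmetric] le_graded_subset)

lemma graded_subset_trans: "inf (graded_subset f e) (graded_subset e k) \<le> graded_subset f k"
  unfolding le_graded_subset
proof
  fix u
  have "inf (inf (f u) (graded_subset f e)) (graded_subset e k) \<le> inf (e u) (graded_subset e k)"
    by (rule inf_mono[OF graded_subset_mp order_refl])
  also have "\<dots> \<le> k u"
    by (rule graded_subset_mp)
  finally show "inf (f u) (inf (graded_subset f e) (graded_subset e k)) \<le> k u"
    by (simp add: inf.assoc)
qed

text \<open>The graded form of \<open>pol_galois\<close>: a bound \<open>c\<close> is below either
  side iff the meet of \<open>f u\<close>, \<open>g w\<close> and \<open>c\<close> is below
  \<open>R u w\<close> for all \<open>u\<close>, \<open>w\<close>.\<close>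

lemma lift_rel_swap: "lift_rel R f g = graded_subset g (pol1 R f)"
  by (rule le_iff_eqI)
    (auto simp: lift_rel_def le_graded_subset le_pol0 le_pol1 inf.left_commute)

lemma graded_subset_point: "graded_subset (point top u) e = e u"
  by (rule le_iff_eqI) (auto simp: le_graded_subset point_def)

lemma lift_rel_point: "lift_rel R (point top u) (point top w) = R u w"
  by (simp add: lift_rel_def graded_subset_point pol0_point top_himp)

lemma graded_subset_inf:
  "graded_subset f (\<lambda>u. inf (e u) (k u)) = inf (graded_subset f e) (graded_subset f k)"
  by (rule le_iff_eqI) (auto simp: le_graded_subset)

lemma graded_subset_top: "graded_subset f (\<lambda>_. top) = top"
  by (simp add: top_unique[symmetric] le_graded_subset)

text \<open>A Yoneda argument. At the index \<open>i\<close> the weight is \<open>top\<close> by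
  reflexivity of inclusion, so the infimum is at most \<open>graded_subset e k\<close>; transitivity
  makes that value a lower bound at every other index.\<close>

lemma INF_graded_subset_attained:
  assumes "n i = e"
  shows "(INF b. graded_subset (n b) e \<rightarrow>\<^sub>H graded_subset (n b) k) = graded_subset e k"
proof (rule antisym)
  have "(INF b. graded_subset (n b) e \<rightarrow>\<^sub>H graded_subset (n b) k)
      \<le> (graded_subset e e \<rightarrow>\<^sub>H graded_subset e k)"
    by (rule INF_lower2[of i]) (auto simp: assms)
  also have "\<dots> = graded_subset e k"
    by (simp add: graded_subset_refl top_himp)
  finally show "(INF b. graded_subset (n b) e \<rightarrow>\<^sub>H graded_subset (n b) k) \<le> graded_subset e k" .
  show "graded_subset e k \<le> (INF b. graded_subset (n b) e \<rightarrow>\<^sub>H graded_subset (n b) k)"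
    by (simp add: le_INF_iff himp_residual graded_subset_trans)
qed

section \<open>The model on names\<close>

text \<open>\<open>J\<close> is consulted on given names and atomic concepts only; its values at
  reserved names are discarded, since they may be arbitrary. The modal names receive the closed
  extension generated by the image under the relation.\<close>

primrec obj_ext :: "('a, 'x, 'h::complete_distrib_lattice, 'r, 's) efc
    \<Rightarrow> ('a, 'x, 'h, 'o, 'f, 'd, 'r, 's) interp \<Rightarrow> ('o, 'd, 'r, 's) obj \<Rightarrow> 'a \<Rightarrow> 'h" where
  "obj_ext F J (Obj b) = point top (iobj J (Obj b))"
| "obj_ext F J (CObj C) = fst (cval F (iatom J) C)"
| "obj_ext F J (DiaObj s b) = pol0 (inc F) (pol0 (rdia F s) (obj_ext F J b))"
| "obj_ext F J (BDiaObj r b) = pol0 (inc F) (pol1 (rbox F r) (obj_ext F J b))"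

primrec feat_int :: "('a, 'x, 'h::complete_distrib_lattice, 'r, 's) efc
    \<Rightarrow> ('a, 'x, 'h, 'o, 'f, 'd, 'r, 's) interp \<Rightarrow> ('f, 'd, 'r, 's) feat \<Rightarrow> 'x \<Rightarrow> 'h" where
  "feat_int F J (Feat y) = point top (ifeat J (Feat y))"
| "feat_int F J (CFeat C) = snd (cval F (iatom J) C)"
| "feat_int F J (BoxFeat r y) = pol1 (inc F) (pol0 (rbox F r) (feat_int F J y))"
| "feat_int F J (BBoxFeat s y) = pol1 (inc F) (pol1 (rdia F s) (feat_int F J y))"

definition name_context :: "('a, 'x, 'h::complete_distrib_lattice, 'r, 's) efc
    \<Rightarrow> ('a, 'x, 'h, 'o, 'f, 'd, 'r, 's) interp
    \<Rightarrow> (('o, 'd, 'r, 's) obj, ('f, 'd, 'r, 's) feat, 'h, 'r, 's) efc" where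
  "name_context F J = \<lparr>
     inc = \<lambda>b y. lift_rel (inc F) (obj_ext F J b) (feat_int F J y),
     rbox = \<lambda>r b y. lift_rel (rbox F r) (obj_ext F J b) (feat_int F J y),
     rdia = \<lambda>s y b. lift_rel (rdia F s) (feat_int F J y) (obj_ext F J b)\<rparr>"

text \<open>Atoms are read off from their classifying names, so the base case of
  \<open>cval_name\<close> holds by definition.\<close>

definition name_interp :: "('a, 'x, 'h::complete_distrib_lattice, 'r, 's) efc
    \<Rightarrow> ('a, 'x, 'h, 'o, 'f, 'd, 'r, 's) interp
    \<Rightarrow> (('o, 'd, 'r, 's) obj, ('f, 'd, 'r, 's) feat, 'h, 'o, 'f, 'd, 'r, 's) interp" where
  "name_interp F J = \<lparr>iobj = id, ifeat = id,
     iatom = \<lambda>D. (\<lambda>b. inc (name_context F J) b (CFeat (Atom D)),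
                  \<lambda>y. inc (name_context F J) (CObj (Atom D)) y)\<rparr>"

lemma name_context_sel:
  "inc (name_context F J) b y = lift_rel (inc F) (obj_ext F J b) (feat_int F J y)"
  "rbox (name_context F J) r b y = lift_rel (rbox F r) (obj_ext F J b) (feat_int F J y)"
  "rdia (name_context F J) s y b = lift_rel (rdia F s) (feat_int F J y) (obj_ext F J b)"
  by (simp_all add: name_context_def)

locale fcontext_interp =
  fixes F :: "('a, 'x, 'h::complete_distrib_lattice, 'r, 's) efc"
    and J :: "('a, 'x, 'h, 'o, 'f, 'd, 'r, 's) interp"
  assumes enriched: "enriched_fcontext F"
    and atoms: "is_fconcept (inc F) (iatom J D)"
begin

abbreviation "N \<equiv> name_context F J"
abbreviation "K \<equiv> name_interp F J"
abbreviation "cext C \<equiv> fst (cval F (iatom J) C)"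
abbreviation "cint C \<equiv> snd (cval F (iatom J) C)"

lemma concept: "pol1 (inc F) (cext C) = cint C" "pol0 (inc F) (cint C) = cext C"
  using is_fconcept_cval[OF enriched atoms, where C = C] by (simp_all add: is_fconcept_def)

lemma box_stable:
  "pol0 (inc F) (pol1 (inc F) (pol0 (rbox F r) g)) = pol0 (rbox F r) g"
  "pol1 (inc F) (pol0 (inc F) (pol1 (rbox F r) f)) = pol1 (rbox F r) f"
  using enriched by (simp_all add: enriched_fcontext_def compat_box_stable)

lemma dia_stable:
  "pol1 (inc F) (pol0 (inc F) (pol0 (rdia F s) f)) = pol0 (rdia F s) f"
  "pol0 (inc F) (pol1 (inc F) (pol1 (rdia F s) g)) = pol1 (rdia F s) g"
  using enriched by (simp_all add: enriched_fcontext_def compat_dia_stable)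

section \<open>Adjunction identities for the modal names\<close>

lemma obj_ext_dia_obj: "obj_ext F J (dia_obj s b) = obj_ext F J (DiaObj s b)"
  by (cases b) (simp_all add: Let_def)

lemma feat_int_box_feat: "feat_int F J (box_feat r y) = feat_int F J (BoxFeat r y)"
  by (cases y) (simp_all add: Let_def)

text \<open>Unfolding the left side yields the closure of \<open>pol0 (rbox F r)\<close> applied to
  the graded set of \<open>y\<close>, and compatibility of \<open>F\<close> removes the closure. The
  next three identities follow the same pattern, with \<open>lift_rel_swap\<close> choosing the side
  on which the closure appears.\<close>

lemma inc_box: "inc N b (BoxFeat r y) = rbox N r b y"
  by (simp add: name_context_sel lift_rel_def box_stable)

lemma inc_bdia: "inc N (BDiaObj r b) y = rbox N r b y"
  by (simp add: name_context_sel lift_rel_swap box_stable)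

lemma inc_dia: "inc N (DiaObj s b) y = rdia N s y b"
  by (simp add: name_context_sel lift_rel_swap[of "inc F"] lift_rel_def[of "rdia F s"] dia_stable)

lemma inc_bbox: "inc N b (BBoxFeat s y) = rdia N s y b"
  by (simp add: name_context_sel lift_rel_swap[of "rdia F s"] lift_rel_def[of "inc F"] dia_stable)

text \<open>Naming the box of \<open>x_C\<close> by the classifying feature of
  \<open>Box r C\<close> is harmless: \<open>cval\<close> builds the intension of
  \<open>Box r C\<close> by the same formula as \<open>feat_int\<close> does for
  \<open>BoxFeat\<close>.\<close>

lemma inc_box_feat: "inc N b (box_feat r y) = rbox N r b y"
  using inc_box[of b r y] by (simp add: name_context_sel(1) feat_int_box_feat del: feat_int.simps)

lemma inc_dia_obj: "inc N (dia_obj s b) y = rdia N s y b"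
  using inc_dia[of s b y] by (simp add: name_context_sel(1) obj_ext_dia_obj del: obj_ext.simps)

lemma enriched_name_context: "enriched_fcontext N"
proof -
  \<comment> \<open>Each image of a point under a lifted relation is a polar of a point at the
    adjoint name, and polars are stable by \<open>pol010\<close> and \<open>pol101\<close>.\<close>
  have "pol0 (rbox N r) (point \<alpha> y) = pol0 (inc N) (point \<alpha> (BoxFeat r y))" for r \<alpha> y
    by (rule ext) (simp add: pol0_point inc_box)
  moreover have "pol1 (rbox N r) (point \<alpha> b) = pol1 (inc N) (point \<alpha> (BDiaObj r b))" for r \<alpha> b
    by (rule ext) (simp add: pol1_point inc_bdia)
  moreover have "pol0 (rdia N s) (point \<alpha> b) = pol1 (inc N) (point \<alpha> (DiaObj s b))" for s \<alpha> b
    by (rule ext) (simp add: pol0_point pol1_point inc_dia)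
  moreover have "pol1 (rdia N s) (point \<alpha> y) = pol0 (inc N) (point \<alpha> (BBoxFeat s y))" for s \<alpha> y
    by (rule ext) (simp add: pol0_point pol1_point inc_bbox)
  ultimately show ?thesis
    by (simp add: enriched_fcontext_def compat_box_def compat_dia_def
        stable_ext_def stable_int_def pol010 pol101)
qed

section \<open>Concepts evaluated through classifying names\<close>

lemma inc_CFeat: "inc N b (CFeat C) = graded_subset (obj_ext F J b) (cext C)"
  by (simp add: name_context_sel lift_rel_def concept)

lemma inc_CObj: "inc N (CObj C) y = graded_subset (feat_int F J y) (cint C)"
  by (simp add: name_context_sel lift_rel_swap concept)

text \<open>The infimum over object names is attained at \<open>CObj C\<close>, whose graded set is
  exactly the extension of \<open>C\<close>. The dual lemma uses \<open>CFeat C\<close>.\<close>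

lemma pol1_inc: "pol1 (inc N) (\<lambda>b. inc N b (CFeat C)) = inc N (CObj C)"
proof
  fix y
  have "pol1 (inc N) (\<lambda>b. inc N b (CFeat C)) y
      = graded_subset (cext C) (pol0 (inc F) (feat_int F J y))"
    using INF_graded_subset_attained[of "obj_ext F J" "CObj C" "cext C"]
    by (simp add: pol1_def name_context_sel lift_rel_def concept)
  then show "pol1 (inc N) (\<lambda>b. inc N b (CFeat C)) y = inc N (CObj C) y"
    by (simp add: name_context_sel lift_rel_def)
qed

lemma pol0_inc: "pol0 (inc N) (inc N (CObj C)) = (\<lambda>b. inc N b (CFeat C))"
proof
  fix b
  have "pol0 (inc N) (inc N (CObj C)) b = graded_subset (cint C) (pol1 (inc F) (obj_ext F J b))"
    using INF_graded_subset_attained[of "feat_int F J" "CFeat C" "cint C"]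
    by (simp add: pol0_def name_context_sel lift_rel_swap concept)
  then show "pol0 (inc N) (inc N (CObj C)) b = inc N b (CFeat C)"
    by (simp add: name_context_sel lift_rel_swap)
qed

text \<open>Attained at \<open>CFeat C\<close>, the infimum becomes the lifted relation at
  \<open>cint C\<close>; read from the object side, that is inclusion in
  \<open>pol0 (rbox F r) (cint C)\<close>, the extension of \<open>Box r C\<close>.\<close>

lemma pol0_rbox: "pol0 (rbox N r) (inc N (CObj C)) = (\<lambda>b. inc N b (CFeat (Box r C)))"
proof
  fix b
  have "pol0 (rbox N r) (inc N (CObj C)) b = lift_rel (rbox F r) (obj_ext F J b) (cint C)"
    using INF_graded_subset_attained[of "feat_int F J" "CFeat C" "cint C"]
    by (simp add: pol0_def name_context_sel lift_rel_swap concept)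
  then show "pol0 (rbox N r) (inc N (CObj C)) b = inc N b (CFeat (Box r C))"
    by (simp add: lift_rel_def inc_CFeat Let_def)
qed

lemma pol0_rdia: "pol0 (rdia N s) (\<lambda>b. inc N b (CFeat C)) = inc N (CObj (Dia s C))"
proof
  fix y
  have "pol0 (rdia N s) (\<lambda>b. inc N b (CFeat C)) y = lift_rel (rdia F s) (feat_int F J y) (cext C)"
    \<comment> \<open>The infimum runs over objects, so both factors must be inclusions of
      \<open>obj_ext F J b\<close>: \<open>inc\<close> has this form already, while
      \<open>rdia\<close> has its object in second place and must be swapped.\<close>
    using INF_graded_subset_attained[of "obj_ext F J" "CObj C" "cext C"]
    by (simp add: pol0_def[of "rdia N s"] name_context_sel lift_rel_def[of "inc F"]
        lift_rel_swap[of "rdia F s"] concept)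
  then show "pol0 (rdia N s) (\<lambda>b. inc N b (CFeat C)) y = inc N (CObj (Dia s C)) y"
    by (simp add: lift_rel_def inc_CObj Let_def)
qed

lemma cval_name: "cval N (iatom K) C = (\<lambda>b. inc N b (CFeat C), inc N (CObj C))"
proof (induction C)
  case (Atom D)
  show ?case by (simp add: name_interp_def)
next
  case Top
  have "(\<lambda>b. inc N b (CFeat Top)) = (\<lambda>_. top)"
    by (simp add: inc_CFeat graded_subset_top)
  then show ?case using pol1_inc[of Top] by simp
next
  case Bot
  have "inc N (CObj Bot) = (\<lambda>_. top)"
    by (simp add: inc_CObj graded_subset_top fun_eq_iff)
  then show ?case using pol0_inc[of Bot] by simp
next
  case (And C D)
  have "(\<lambda>b. inc N b (CFeat (And C D))) = (\<lambda>b. inf (inc N b (CFeat C)) (inc N b (CFeat D)))"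
    by (simp add: inc_CFeat graded_subset_inf Let_def)
  then show ?case using pol1_inc[of "And C D"] And by simp
next
  case (Or C D)
  have "inc N (CObj (Or C D)) = (\<lambda>y. inf (inc N (CObj C) y) (inc N (CObj D) y))"
    by (simp add: inc_CObj graded_subset_inf Let_def fun_eq_iff)
  then show ?case using pol0_inc[of "Or C D"] Or by simp
next
  case (Box r C)
  then show ?case by (simp add: pol0_rbox pol1_inc)
next
  case (Dia s C)
  then show ?case by (simp add: pol0_rdia pol0_inc)
qed

section \<open>Values of assertions and soundness of the rules\<close>

lemma tval_name:
  "tval N K (ObjIn b C) = inc N b (CFeat C)" "tval N K (FeatIn y C) = inc N (CObj C) y"
  "tval N K (Inc b y) = inc N b y"
  "tval N K (RBox r b y) = rbox N r b y" "tval N K (RDia s y b) = rdia N s y b"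
  by (simp_all add: cval_name) (simp_all add: name_interp_def)

lemma given_names:
  "inc N (Obj b) (Feat y) = inc F (iobj J (Obj b)) (ifeat J (Feat y))"
  "rbox N r (Obj b) (Feat y) = rbox F r (iobj J (Obj b)) (ifeat J (Feat y))"
  "rdia N s (Feat y) (Obj b) = rdia F s (ifeat J (Feat y)) (iobj J (Obj b))"
  by (simp_all add: name_context_sel lift_rel_point)

text \<open>Given names denote crisp points, at which lifted relations and inclusions return the
  original values. Equality, not just an inequality, lets negative assertions transfer too.\<close>

lemma tval_given: "given_names_only t \<Longrightarrow> tval N K t = tval F J t"
  by (cases t) (auto simp: tval_name tval.simps[of F J] inc_CFeat inc_CObj graded_subset_point
      given_names simp del: tval.simps)

lemma concept_incidence: "inf (inc N b (CFeat C)) (inc N (CObj C) y) \<le> inc N b y"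
  using eq_refl[OF fun_cong[OF pol1_inc[of C, symmetric], of y]] by (simp add: le_pol1)

lemma box_incidence: "inf (inc N b (CFeat (Box r C))) (inc N (CObj C) y) \<le> rbox N r b y"
  using eq_refl[OF fun_cong[OF pol0_rbox[of r C, symmetric], of b]]
  by (simp add: le_pol0 inf_commute)

lemma dia_incidence: "inf (inc N (CObj (Dia s C)) y) (inc N b (CFeat C)) \<le> rdia N s y b"
  using eq_refl[OF fun_cong[OF pol0_rdia[of s C, symmetric], of y]]
  by (simp add: le_pol0 inf_commute)

lemma inc_And: "inc N b (CFeat (And C D)) = inf (inc N b (CFeat C)) (inc N b (CFeat D))"
  by (simp add: inc_CFeat graded_subset_inf Let_def)

lemma inc_Or: "inc N (CObj (Or C D)) y = inf (inc N (CObj C) y) (inc N (CObj D) y)"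
  by (simp add: inc_CObj graded_subset_inf Let_def)

lemma inc_classifying: "inc N (CObj C) (CFeat C) = top"
  by (simp add: inc_CFeat graded_subset_refl)

lemma expands_sound:
  assumes "expands \<A> \<A>'" and sat: "\<And>\<phi>. \<phi> \<in> \<A> \<Longrightarrow> sat N K \<phi>" and "\<phi> \<in> \<A>'"
  shows "sat N K \<phi>"
proof (cases "\<phi> \<in> \<A>")
  case False
  have leq: "\<alpha> \<le> tval N K t" if "Leq \<alpha> t \<in> \<A>" for \<alpha> t
    using sat[OF that] by simp
  have nleq: "\<not> \<alpha> \<le> tval N K t" if "NLeq \<alpha> t \<in> \<A>" for \<alpha> t
    using sat[OF that] by simp
  note simps = tval_name inc_box_feat inc_dia_obj inc_bbox inc_bdia inc_And inc_Or inc_classifying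
  from assms(1) show ?thesis
  proof cases
    case (I_rule \<alpha>1 b C \<alpha>2 y)
    then have "inf \<alpha>1 \<alpha>2 \<le> inc N b y"
      using order_trans[OF inf_mono concept_incidence] leq
      by (metis tval_name(1,2))
    with I_rule False \<open>\<phi> \<in> \<A>'\<close> show ?thesis
      by (simp add: simps del: tval.simps)
  next
    case (box_rule \<alpha>1 b r C \<alpha>2 y)
    then have "inf \<alpha>1 \<alpha>2 \<le> rbox N r b y"
      using order_trans[OF inf_mono box_incidence] leq
      by (metis tval_name(1,2))
    with box_rule False \<open>\<phi> \<in> \<A>'\<close> show ?thesis
      by (simp add: simps del: tval.simps)
  next
    case (dia_rule \<alpha>1 y s C \<alpha>2 b)
    then have "inf \<alpha>1 \<alpha>2 \<le> rdia N s y b"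
      using order_trans[OF inf_mono dia_incidence] leq
      by (metis tval_name(1,2))
    with dia_rule False \<open>\<phi> \<in> \<A>'\<close> show ?thesis
      by (simp add: simps del: tval.simps)
  \<comment> \<open>The remaining rules reduce to equalities of values or lattice laws: membership
    in \<open>C\<close> is incidence with its classifying name (negative, appending), modal names
    realise the adjunctions, and \<open>inc_classifying\<close> yields creation.\<close>
  qed (use False \<open>\<phi> \<in> \<A>'\<close> in
      \<open>auto simp: simps simp del: tval.simps dest!: leq nleq intro: le_infI1 le_infI2\<close>)
qed (rule sat)

text \<open>Satisfaction by \<open>J\<close> is transferred to \<open>K\<close> for the input ABox
  only; everything added later, which may mention reserved names, is derived again in
  \<open>K\<close> by soundness of the rules.\<close>

lemma le_falc_abox_sound:
  assumes "le_falc_abox \<A>" "\<And>\<phi>. \<phi> \<in> \<A> \<Longrightarrow> sat F J \<phi>" "\<phi> \<in> \<A>"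
  shows "sat N K \<phi>"
  using assms
proof (induction arbitrary: \<phi>)
  case (input \<A>)
  then show ?case
    using tval_given by (cases \<phi>) (metis sat.simps term_of.simps)+
next
  case (expand \<A> \<A>')
  \<comment> \<open>Rules only add assertions, so \<open>J\<close> also satisfies the earlier ABox
    and the induction hypothesis applies.\<close>
  have "\<A> \<subseteq> \<A>'"
    using expand.hyps(2) by cases auto
  then show ?case
    using expand expands_sound by blast
qed

lemma is_model_name:
  assumes "\<And>\<phi>. \<phi> \<in> \<A> \<Longrightarrow> sat N K \<phi>"
  shows "is_model N K \<A>"
  using assms enriched_name_context pol1_inc pol0_inc
  by (simp add: is_model_def is_fconcept_def name_interp_def)

end

theorem theorem4:
  fixes \<A> \<A>' :: "('o, 'f, 'd, 'r, 's, 'h::complete_distrib_lattice) abox"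
  assumes "le_falc_abox \<A>"
    and "consistent_in TYPE('a) TYPE('x) \<A>"
    and "expands \<A> \<A>'"
  shows "consistent_in TYPE(('o, 'd, 'r, 's) obj) TYPE(('f, 'd, 'r, 's) feat) \<A>'"
proof -
  obtain F :: "('a, 'x, 'h, 'r, 's) efc" and J where model: "is_model F J \<A>"
    using assms(2) unfolding consistent_in_def by blast
  interpret fcontext_interp F J
    using model by unfold_locales (auto simp: is_model_def)
  have "sat N K \<phi>" if "\<phi> \<in> \<A>" for \<phi>
    using le_falc_abox_sound[OF assms(1) _ that] model by (auto simp: is_model_def)
  then have "is_model N K \<A>'"
    by (rule is_model_name[OF expands_sound[OF assms(3)]])
  then show ?thesis
    unfolding consistent_in_def by blast
qed

end
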